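(* There is a constant $M$ depending only on $d_y,d_r,\underline d$ (and not on $m$, $T$, the sets $Z_t$ or $\Psi$) such that the following holds. Suppose the step sizes are $\eta_t=\min\{\frac1m,\frac1{\sqrt{mt}}\}$ for all $t=1,\dots,T$. Under the uniform random permutation model ($\Omega_t=Z_{\pi(t)}$ with $\pi$ a uniformly random permutation of $\{1,\dots,T\}$), the primal-dual algorithm satisfies $$\mathbb E_\pi\Big[\sum_{t=1}^T r_t\Big]\ge z_R-M\sqrt{m\log m}\,\sqrt T,$$ where $\log m$ is read as $\max\{1,\log m\}$.
   Context: Setting. $T,m\ge 1$ are integers. $\Psi\subseteq\mathbb R^m$ is a closed convex set that is Motzkin decomposable: $\Psi=Q+C$ with $Q$ a nonempty compact convex set and $C$ a closed convex cone (the recession cone of $\Psi$). $C^\circ=\{p\in\mathbb R^m:p^\top c\le 0\ \forall c\in C\}$ is the polar cone of $C$, and $\mathrm{proj}_{C^\circ}$ is Euclidean projection. Uniform random permutation model. $Z_1,\dots,Z_T$ are fixed deterministic nonempty compact (possibly non-convex) sets of decisions $(r,x,y)$ with $r\in\mathbb R$ (reward), $x$ in some finite-dimensional real space, $y\in\mathbb R^m$ (fairness impact). The local feasible set at time $t$ is $\Omega_t=Z_{\pi(t)}$, where $\pi$ is drawn uniformly from all $T!$ permutations of $\{1,\dots,T\}$; $\mathbb E_\pi$ denotes expectation over $\pi$. Benchmark. $z_R=\max\{\sum_{t=1}^T r_t:(r_t,x_t,y_t)\in\mathrm{conv}(\Omega_t),\ t=1,\dots,T,\ \sum_{t=1}^T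 y_t\in T\Psi\}$, assumed feasible; its value does not depend on $\pi$. Regularity assumptions. There are constants $d_y,d_r,\underline d>0$ with $d_y=O(1)$, $d_r=O(1)$, $\underline d=\Omega(1)$ such that for every local feasible set $\Omega_t$ (equivalently every $Z_t$): (1) $\max_{v\in Q}\|y-v\|_\infty\le d_y$ for every $(r,x,y)\in\Omega_t$; (2) there is $(\tilde r_t,\tilde x_t,\tilde y_t)\in\mathrm{conv}(\Omega_t)$ with $\tilde r_t\ge\max_{(r,x,y)\in\Omega_t}r-d_r$ and $\{\tilde y_t\}+\underline dB_m\subseteq\Psi$, where $B_m$ is the unit Euclidean ball of $\mathbb R^m$. Primal-dual algorithm. Set $p_1=\mathbf 0$. For $t=1,\dots,T$: after observing $\Omega_t$, choose $(r_t,x_t,y_t)\in\arg\max\{r-p_t^\top y:(r,x,y)\in\Omega_t\}$; choose $v_t\in\arg\max_{v\in Q}p_t^\top v$ (any such $v_t$ also maximizes $p_t^\top v$ over $\Psi$ since $p_t\in C^\circ$); set $p_{t+1}=\mathrm{proj}_{C^\circ}(p_t-\eta_t(v_t-y_t))$. The algorithm is online: the choices at time $t$ (including tie-breaking) are determined by $\Omega_1,\dots,\Omega_t$ only. *)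

theory Defs
  imports
    "HOL-Analysis.Analysis"
    "HOL-Probability.Probability"
    "HOL-Combinatorics.Permutations"
    "HOL-Library.Function_Algebras"
begin

text \<open>
  The constant in the theorem must be uniform in the dimensions, so these cannot be types.
  \<open>\<real>\<^sup>k\<close> is the set of functions \<open>nat \<Rightarrow> real\<close> vanishing outside \<open>{..<k}\<close>, with the pointwise
  vector space structure. The library's topology on \<open>nat \<Rightarrow> real\<close> is the product topology; the set
  \<open>coord_space k\<close> is closed in it, and carries the Euclidean topology as its subspace topology, so
  \<open>closed\<close> and \<open>compact\<close> have their usual meaning for subsets of \<open>coord_space k\<close>. The library's
  metric on \<open>nat \<Rightarrow> real\<close> is not the Euclidean one, whence the explicit norms below.
\<close>

instantiation "fun" :: (type, real_vector) real_vector
begin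

definition scaleR_fun :: "real \<Rightarrow> ('a \<Rightarrow> 'b) \<Rightarrow> 'a \<Rightarrow> 'b"
  where "scaleR_fun c f = (\<lambda>x. c *\<^sub>R f x)"

instance
  by standard (simp_all add: scaleR_fun_def fun_eq_iff scaleR_add_left scaleR_add_right)

end

type_synonym rvec = "nat \<Rightarrow> real"

definition coord_space :: "nat \<Rightarrow> rvec set"
  where "coord_space k = {v. \<forall>i\<ge>k. v i = 0}"

definition dot :: "nat \<Rightarrow> rvec \<Rightarrow> rvec \<Rightarrow> real"
  where "dot k u v = (\<Sum>i<k. u i * v i)"

definition eucl_norm :: "nat \<Rightarrow> rvec \<Rightarrow> real"
  where "eucl_norm k v = L2_set v {..<k}"

definition max_norm :: "nat \<Rightarrow> rvec \<Rightarrow> real"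
  where "max_norm k v = (MAX i\<in>{..<k}. \<bar>v i\<bar>)"

definition eucl_proj :: "nat \<Rightarrow> rvec set \<Rightarrow> rvec \<Rightarrow> rvec"
  where "eucl_proj k S a = (ARG_MIN (\<lambda>x. eucl_norm k (a - x)) x. x \<in> S)"

definition polar_cone :: "nat \<Rightarrow> rvec set \<Rightarrow> rvec set"
  where "polar_cone k C = {p \<in> coord_space k. \<forall>c\<in>C. dot k p c \<le> 0}"

text \<open>Since \<open>Q\<close> is compact, the decomposition forces \<open>C\<close> to be the recession cone of \<open>\<Psi>\<close>.\<close>

definition motzkin_decomposition :: "nat \<Rightarrow> rvec set \<Rightarrow> rvec set \<Rightarrow> rvec set \<Rightarrow> bool"
  where "motzkin_decomposition m \<Psi> Q C \<longleftrightarrow>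
    \<Psi> \<subseteq> coord_space m \<and> closed \<Psi> \<and> convex \<Psi> \<and>
    Q \<subseteq> coord_space m \<and> Q \<noteq> {} \<and> compact Q \<and> convex Q \<and>
    C \<subseteq> coord_space m \<and> closed C \<and> convex_cone C \<and>
    \<Psi> = {q + c |q c. q \<in> Q \<and> c \<in> C}"

text \<open>A decision is a triple \<open>(r, x, y)\<close>.\<close>

type_synonym decision = "real \<times> rvec \<times> rvec"

definition reward :: "decision \<Rightarrow> real"
  where "reward z = fst z"

definition impact :: "decision \<Rightarrow> rvec"
  where "impact z = snd (snd z)"

definition local_feasible_set :: "nat \<Rightarrow> nat \<Rightarrow> decision set \<Rightarrow> bool"
  where "local_feasible_set m n S \<longleftrightarrow>
    S \<subseteq> UNIV \<times> coord_space n \<times> coord_space m \<and> S \<noteq> {} \<and> compact S"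

definition regular ::
    "nat \<Rightarrow> rvec set \<Rightarrow> rvec set \<Rightarrow> real \<Rightarrow> real \<Rightarrow> real \<Rightarrow> decision set \<Rightarrow> bool"
  where "regular m \<Psi> Q dy dr dd S \<longleftrightarrow>
    (\<forall>z\<in>S. \<forall>v\<in>Q. max_norm m (impact z - v) \<le> dy) \<and>
    (\<exists>z'\<in>convex hull S.
       (\<forall>z\<in>S. reward z' \<ge> reward z - dr) \<and>
       {impact z' + dd *\<^sub>R u |u. u \<in> coord_space m \<and> eucl_norm m u \<le> 1} \<subseteq> \<Psi>)"

definition benchmark_values :: "nat \<Rightarrow> rvec set \<Rightarrow> (nat \<Rightarrow> decision set) \<Rightarrow> real set"
  where "benchmark_values T \<Psi> \<Omega> =
    {(\<Sum>t=1..T. reward (w t)) |w.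
       (\<forall>t\<in>{1..T}. w t \<in> convex hull (\<Omega> t)) \<and>
       (\<Sum>t=1..T. impact (w t)) \<in> (\<lambda>u. real T *\<^sub>R u) ` \<Psi>}"

text \<open>
  When the benchmark problem is feasible, the supremum is a maximum: the sets \<open>\<Omega> t\<close> are compact
  in finite dimension, hence so are their convex hulls, and \<open>\<Psi>\<close> is closed.
\<close>

definition benchmark :: "nat \<Rightarrow> rvec set \<Rightarrow> (nat \<Rightarrow> decision set) \<Rightarrow> real"
  where "benchmark T \<Psi> \<Omega> = Sup (benchmark_values T \<Psi> \<Omega>)"

lemma benchmark_values_permute_subset:
  assumes "\<pi> permutes {1..T}"
  shows "benchmark_values T \<Psi> \<Omega> \<subseteq> benchmark_values T \<Psi> (\<Omega> \<circ> \<pi>)"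
proof
  fix s assume "s \<in> benchmark_values T \<Psi> \<Omega>"
  then obtain w where s: "s = (\<Sum>t=1..T. reward (w t))"
    and w: "\<And>t. t \<in> {1..T} \<Longrightarrow> w t \<in> convex hull (\<Omega> t)"
    and y: "(\<Sum>t=1..T. impact (w t)) \<in> (\<lambda>u. real T *\<^sub>R u) ` \<Psi>"
    unfolding benchmark_values_def by blast
  have "s = (\<Sum>t=1..T. reward ((w \<circ> \<pi>) t))"
    unfolding s using sum.permute[OF assms, of "\<lambda>t. reward (w t)"] by (simp add: o_def)
  moreover have "(w \<circ> \<pi>) t \<in> convex hull ((\<Omega> \<circ> \<pi>) t)" if "t \<in> {1..T}" for t
    using w[of "\<pi> t"] that permutes_in_image[OF assms, of t] by simp
  moreover have "(\<Sum>t=1..T. impact ((w \<circ> \<pi>) t)) = (\<Sum>t=1..T. impact (w t))"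
    using sum.permute[OF assms, of "\<lambda>t. impact (w t)"] by (simp add: o_def)
  ultimately show "s \<in> benchmark_values T \<Psi> (\<Omega> \<circ> \<pi>)"
    using y unfolding benchmark_values_def by (intro CollectI exI[of _ "w \<circ> \<pi>"]) auto
qed

text \<open>The benchmark does not depend on the arrival order.\<close>

lemma benchmark_permute:
  assumes "\<pi> permutes {1..T}"
  shows "benchmark T \<Psi> (\<Omega> \<circ> \<pi>) = benchmark T \<Psi> \<Omega>"
proof -
  have "(\<Omega> \<circ> \<pi>) \<circ> inv \<pi> = \<Omega>"
    using permutes_inv_o(1)[OF assms] by (simp add: comp_assoc)
  then have "benchmark_values T \<Psi> (\<Omega> \<circ> \<pi>) = benchmark_values T \<Psi> \<Omega>"
    using benchmark_values_permute_subset[OF assms, of \<Psi> \<Omega>]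
      benchmark_values_permute_subset[OF permutes_inv[OF assms], of \<Psi> "\<Omega> \<circ> \<pi>"]
    by auto
  then show ?thesis
    by (simp add: benchmark_def)
qed

definition step_size :: "nat \<Rightarrow> nat \<Rightarrow> real"
  where "step_size m t = min (1 / real m) (1 / sqrt (real m * real t))"

text \<open>
  One run of the primal-dual algorithm on the stream \<open>\<Omega> 1, \<dots>, \<Omega> T\<close>: primal choices \<open>w\<close>, choices
  \<open>v\<close> in \<open>Q\<close>, dual iterates \<open>p\<close>, step sizes \<open>\<eta>\<close>.
\<close>

definition primal_dual_run ::
    "nat \<Rightarrow> nat \<Rightarrow> rvec set \<Rightarrow> rvec set \<Rightarrow> (nat \<Rightarrow> real) \<Rightarrow> (nat \<Rightarrow> decision set) \<Rightarrow>
     (nat \<Rightarrow> decision) \<Rightarrow> (nat \<Rightarrow> rvec) \<Rightarrow> (nat \<Rightarrow> rvec) \<Rightarrow> bool"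
  where "primal_dual_run m T Q C \<eta> \<Omega> w v p \<longleftrightarrow>
    p 1 = 0 \<and>
    (\<forall>t\<in>{1..T}.
       is_arg_max (\<lambda>z. reward z - dot m (p t) (impact z)) (\<lambda>z. z \<in> \<Omega> t) (w t) \<and>
       is_arg_max (\<lambda>u. dot m (p t) u) (\<lambda>u. u \<in> Q) (v t) \<and>
       p (Suc t) = eucl_proj m (polar_cone m C) (p t - \<eta> t *\<^sub>R (v t - impact (w t))))"

text \<open>
  What has been observed when the choices at time \<open>t\<close> are made. An online algorithm, tie-breaking
  included, is a pair of decision rules applied to these histories.
\<close>

definition history :: "(nat \<Rightarrow> decision set) \<Rightarrow> nat \<Rightarrow> decision set list"
  where "history \<Omega> t = map \<Omega> [1..<Suc t]"

end

theory Submission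
  imports Defs
begin

text \<open>
  Let \<open>z\<^sup>*\<close> be a point feasible for the benchmark and \<open>u\<close> the mean of its impacts \<open>y\<^sup>*\<close>. Optimality
  of the choices at time \<open>t\<close> gives
  \<open>r\<^sub>t \<ge> r\<^sup>* (\<pi> t) - \<langle>p\<^sub>t, v\<^sub>t - y\<^sub>t\<rangle> + \<langle>p\<^sub>t, u - y\<^sup>* (\<pi> t)\<rangle>\<close>. The Slater points keep \<open>p\<^sub>t\<close> in a ball
  whose radius depends only on the constants, so the usual regret bound for projected gradient
  steps controls the sum of the first inner products. For the second, \<open>p\<^sub>t\<close> depends only on the
  first \<open>t - 1\<close> values of \<open>\<pi>\<close>, so in expectation \<open>y\<^sup>* (\<pi> t)\<close> may be averaged over the remaining
  \<open>T - t + 1\<close> positions; sampling without replacement makes the deviation of this average from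
  \<open>u\<close> of order \<open>sqrt (m / (T - t + 1))\<close>, which sums to \<open>sqrt (m * T)\<close>.
\<close>

section \<open>Coordinate spaces\<close>

lemma dot_commute: "dot k u v = dot k v u"
  by (simp add: dot_def mult.commute)

lemma dot_zero [simp]: "dot k 0 v = 0" "dot k u 0 = 0"
  by (simp_all add: dot_def)

lemma dot_add_right: "dot k u (v + w) = dot k u v + dot k u w"
  by (simp add: dot_def distrib_left sum.distrib)

lemma dot_diff_right: "dot k u (v - w) = dot k u v - dot k u w"
  by (simp add: dot_def right_diff_distrib sum_subtractf)

lemma dot_scaleR_right: "dot k u (c *\<^sub>R v) = c * dot k u v"
  by (simp add: dot_def scaleR_fun_def sum_distrib_left mult_ac)

lemma dot_diff_left: "dot k (u - v) w = dot k u w - dot k v w"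
  by (simp add: dot_commute[of k _ w] dot_diff_right)

lemma dot_add_left: "dot k (u + v) w = dot k u w + dot k v w"
  by (simp add: dot_commute[of k _ w] dot_add_right)

lemma dot_scaleR_left: "dot k (c *\<^sub>R u) w = c * dot k u w"
  by (simp add: dot_commute[of k _ w] dot_scaleR_right)

lemmas dot_simps = dot_add_right dot_add_left dot_diff_right dot_diff_left dot_scaleR_right dot_scaleR_left

lemma dot_self_nonneg: "0 \<le> dot k u u"
  by (simp add: dot_def sum_nonneg)

lemma eucl_norm_eq_sqrt_dot: "eucl_norm k u = sqrt (dot k u u)"
  by (simp add: eucl_norm_def L2_set_def dot_def power2_eq_square)

lemma eucl_norm_nonneg: "0 \<le> eucl_norm k u"
  by (simp add: eucl_norm_eq_sqrt_dot dot_self_nonneg)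

lemma eucl_norm_power2: "(eucl_norm k u)\<^sup>2 = dot k u u"
  by (simp add: eucl_norm_eq_sqrt_dot dot_self_nonneg)

lemma eucl_norm_scaleR: "eucl_norm k (c *\<^sub>R u) = \<bar>c\<bar> * eucl_norm k u"
  by (simp add: eucl_norm_eq_sqrt_dot dot_simps real_sqrt_mult flip: mult.assoc)

lemma dot_self_le_of_coord_le:
  assumes "\<And>i. i < k \<Longrightarrow> \<bar>g i\<bar> \<le> d"
  shows "dot k g g \<le> real k * d\<^sup>2"
proof -
  have "dot k g g \<le> (\<Sum>i<k. d\<^sup>2)"
    unfolding dot_def power2_eq_square[symmetric]
    by (intro sum_mono) (metis abs_ge_zero abs_le_square_iff assms lessThan_iff abs_of_nonneg order_trans)
  then show ?thesis by simp
qed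

text \<open>Expand the nonnegative square of \<open>a *\<^sub>R u + v\<close>. This form is linear
  in the two squared norms, so it can be summed over permutations; the weight \<open>a\<close> is
  chosen there.\<close>

lemma young_dot:
  assumes "a > 0"
  shows "- ((a * dot k u u + dot k v v / a) / 2) \<le> dot k u v"
proof -
  have "0 \<le> dot k (a *\<^sub>R u + v) (a *\<^sub>R u + v)"
    by (rule dot_self_nonneg)
  also have "\<dots> = a * (a * dot k u u) + 2 * a * dot k u v + dot k v v"
    by (simp add: dot_simps dot_commute[of k v u] distrib_left)
  also have "\<dots> = (2 * a) * (dot k u v + (a * dot k u u + dot k v v / a) / 2)"
    using assms by (simp add: field_simps)
  finally show ?thesis
    using assms by (simp add: zero_le_mult_iff)
qed

lemma max_norm_le_iff:
  assumes "k \<ge> 1"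
  shows "max_norm k v \<le> d \<longleftrightarrow> (\<forall>i<k. \<bar>v i\<bar> \<le> d)"
  using assms unfolding max_norm_def by (subst Max_le_iff) (auto simp: lessThan_empty_iff)

lemma continuous_on_dot [continuous_intros]:
  assumes "continuous_on S f" "continuous_on S g"
  shows "continuous_on S (\<lambda>x. dot k (f x) (g x))"
  unfolding dot_def
  by (intro continuous_on_sum continuous_on_mult)
    (rule continuous_on_product_then_coordinatewise[OF assms(1)]
      continuous_on_product_then_coordinatewise[OF assms(2)])+

section \<open>Projection onto a polar cone\<close>

lemma polar_cone_zero: "0 \<in> polar_cone k C"
  by (simp add: polar_cone_def coord_space_def)

lemma polar_cone_scaleR: "x \<in> polar_cone k C \<Longrightarrow> 0 \<le> c \<Longrightarrow> c *\<^sub>R x \<in> polar_cone k C"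
  unfolding polar_cone_def
  by (auto simp: dot_simps mult_nonneg_nonpos) (simp add: coord_space_def scaleR_fun_def)

lemma closed_polar_cone: "closed (polar_cone k C)"
proof -
  have "polar_cone k C = (\<Inter>i\<in>{k..}. {x. x i = 0}) \<inter> (\<Inter>c\<in>C. {x. dot k x c \<le> 0})"
    by (auto simp: polar_cone_def coord_space_def)
  moreover have "closed {x :: rvec. x i = 0}" for i
    by (intro closed_Collect_eq continuous_intros continuous_on_product_coordinates)
  moreover have "closed {x. dot k x c \<le> 0}" for c
    by (intro closed_Collect_le continuous_intros)
  ultimately show ?thesis
    by (auto intro!: closed_Int closed_INT)
qed

text \<open>The box is a product of compact factors, with the factor \<open>{0}\<close> at every
  index from \<open>k\<close> on, so Tychonoff's theorem applies.\<close>

lemma compact_coord_box: "compact {x \<in> coord_space k. \<forall>i<k. \<bar>x i\<bar> \<le> B i}"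
proof -
  define F where "F i = (if i < k then {- B i..B i} else {0 :: real})" for i
  have "compact (PiE UNIV F)"
    using compactin_PiE[of "\<lambda>_. euclidean" UNIV F]
    by (auto simp: euclidean_product_topology F_def)
  moreover have "PiE UNIV F = {x \<in> coord_space k. \<forall>i<k. \<bar>x i\<bar> \<le> B i}"
  proof (rule set_eqI)
    fix x :: rvec
    have "x i \<in> F i \<longleftrightarrow> (i \<ge> k \<longrightarrow> x i = 0) \<and> (i < k \<longrightarrow> \<bar>x i\<bar> \<le> B i)" for i
      by (auto simp: F_def)
    then show "x \<in> PiE UNIV F \<longleftrightarrow> x \<in> {x \<in> coord_space k. \<forall>i<k. \<bar>x i\<bar> \<le> B i}"
      by (auto simp: PiE_UNIV_domain Pi_iff coord_space_def)
  qed
  ultimately show ?thesis by simp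
qed

lemma is_arg_min_eucl_proj_polar_cone:
  "is_arg_min (\<lambda>x. eucl_norm k (a - x)) (\<lambda>x. x \<in> polar_cone k C) (eucl_proj k (polar_cone k C) a)"
proof -
  let ?P = "polar_cone k C"
  \<comment> \<open>A point with some coordinate beyond this box is at distance at least
    \<open>eucl_norm k a\<close> from \<open>a\<close>, so it does no better than \<open>0\<close>.
    Minimizing over the compact set \<open>K\<close> therefore suffices.\<close>
  define K where "K = ?P \<inter> {x \<in> coord_space k. \<forall>i<k. \<bar>x i\<bar> \<le> \<bar>a i\<bar> + eucl_norm k a}"
  have "compact K"
    unfolding K_def by (intro closed_Int_compact closed_polar_cone compact_coord_box)
  moreover have K0: "0 \<in> K"
    using polar_cone_zero[of k C] by (auto simp: K_def polar_cone_def eucl_norm_nonneg)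
  moreover have "continuous_on K (\<lambda>x. eucl_norm k (a - x))"
    unfolding eucl_norm_eq_sqrt_dot dot_simps by (intro continuous_intros)
  ultimately obtain x where x: "x \<in> K" "\<And>y. y \<in> K \<Longrightarrow> eucl_norm k (a - x) \<le> eucl_norm k (a - y)"
    using continuous_attains_inf[of K "\<lambda>x. eucl_norm k (a - x)"] by blast
  have "eucl_norm k (a - x) \<le> eucl_norm k (a - y)" if y: "y \<in> ?P" for y
  proof (cases "y \<in> K")
    case False
    then obtain i where i: "i < k" "\<bar>y i\<bar> > \<bar>a i\<bar> + eucl_norm k a"
      using y by (auto simp: K_def polar_cone_def not_le)
    then have "eucl_norm k a \<le> \<bar>(a - y) i\<bar>"
      by simp
    also have "\<dots> \<le> eucl_norm k (a - y)"
      unfolding eucl_norm_def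
      using i(1) member_le_L2_set[of "{..<k}" i "\<lambda>j. \<bar>(a - y) j\<bar>"] by (simp add: L2_set_def)
    finally show ?thesis
      using x(2)[OF K0] by simp
  qed (use x in auto)
  then have "is_arg_min (\<lambda>x. eucl_norm k (a - x)) (\<lambda>x. x \<in> ?P) x"
    using x(1) by (auto simp: is_arg_min_linorder K_def)
  then show ?thesis
    unfolding eucl_proj_def arg_min_def by (rule someI[of "is_arg_min _ _"])
qed

lemma eucl_proj_polar_cone_mem: "eucl_proj k (polar_cone k C) a \<in> polar_cone k C"
  using is_arg_min_eucl_proj_polar_cone[of k a C] by (simp add: is_arg_min_def)

text \<open>Minimality along the ray through the projection \<open>x\<close> forces \<open>\<langle>a, x\<rangle> = \<langle>x, x\<rangle>\<close>.\<close>

lemma dot_self_eucl_proj_polar_cone_le: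
  "dot k (eucl_proj k (polar_cone k C) a) (eucl_proj k (polar_cone k C) a) \<le> dot k a a"
proof -
  define x where "x = eucl_proj k (polar_cone k C) a"
  define b where "b = dot k a x"
  define N where "N = dot k x x"
  have x: "x \<in> polar_cone k C"
    by (simp add: x_def eucl_proj_polar_cone_mem)
  have ray: "N - 2 * b \<le> c * c * N - 2 * c * b" if "c \<ge> 0" for c
  proof -
    have "eucl_norm k (a - x) \<le> eucl_norm k (a - c *\<^sub>R x)"
      using is_arg_min_eucl_proj_polar_cone[of k a C] polar_cone_scaleR[OF x that]
      by (simp add: is_arg_min_linorder x_def)
    then show ?thesis
      by (simp add: eucl_norm_eq_sqrt_dot dot_simps dot_commute[of k x a] algebra_simps flip: b_def N_def)
  qed
  have "N \<ge> 0"
    by (simp add: N_def dot_self_nonneg)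
  have "N \<le> b"
  proof (cases "N = 0")
    case True
    then show ?thesis
      using ray[of 0] by simp
  next
    case False
    then have "N > 0" "b \<ge> 0"
      using \<open>N \<ge> 0\<close> ray[of 0] by auto
    \<comment> \<open>The value \<open>c = b / N\<close> minimizes the quadratic in
      \<open>ray\<close>; the result rearranges to a square being at most zero.\<close>
    then have "N - 2 * b \<le> - (b * b / N)"
      using ray[of "b / N"] by simp
    then have "(N - b)\<^sup>2 \<le> 0"
      using \<open>N > 0\<close> by (simp add: field_simps power2_eq_square)
    then show ?thesis
      by simp
  qed
  moreover have "0 \<le> dot k (a - x) (a - x)"
    by (rule dot_self_nonneg)
  then have "0 \<le> dot k a a - 2 * b + N"
    by (simp add: dot_simps dot_commute[of k x a] flip: b_def N_def)
  ultimately have "N \<le> dot k a a"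
    by linarith
  then show ?thesis
    by (simp add: N_def x_def)
qed

section \<open>Step sizes\<close>

lemma step_size_pos: "m \<ge> 1 \<Longrightarrow> t \<ge> 1 \<Longrightarrow> 0 < step_size m t"
  by (simp add: step_size_def)

lemma step_size_mult_le_1: "m \<ge> 1 \<Longrightarrow> step_size m t * real m \<le> 1"
  by (simp add: step_size_def min_def field_simps)

lemma inverse_step_size:
  assumes "m \<ge> 1" "t \<ge> 1"
  shows "1 / step_size m t = max (real m) (sqrt (real m * real t))"
proof -
  have "0 < real m" "0 < sqrt (real m * real t)"
    using assms by auto
  then show ?thesis
    by (auto simp: step_size_def min_def max_def field_simps)
qed

lemma sum_inverse_sqrt_le: "(\<Sum>t=1..n. 1 / sqrt (real t)) \<le> 2 * sqrt (real n)"
proof (induction n)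
  case (Suc n)
  \<comment> \<open>Each term is at most twice the increment of the square root: since
    \<open>a * a = b * b + 1\<close>, the inequality \<open>1 \<le> 2 * (a - b) * a\<close> says
    that \<open>(a - b) * (a - b)\<close> is nonnegative.\<close>
  have "1 / sqrt (real (Suc n)) \<le> 2 * (sqrt (real (Suc n)) - sqrt (real n))"
  proof -
    define a b where "a = sqrt (real (Suc n))" and "b = sqrt (real n)"
    have a: "a > 0" "a * a = b * b + 1"
      by (simp_all add: a_def b_def)
    moreover have "0 \<le> (a - b) * (a - b)"
      by simp
    ultimately have "1 \<le> 2 * (a - b) * a"
      by (simp add: algebra_simps)
    then show ?thesis
      unfolding a_def[symmetric] b_def[symmetric] using a(1) by (simp add: pos_divide_le_eq)
  qed
  then show ?case
    using Suc by simp
qed simp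

text \<open>The factor \<open>real m\<close> matches the bound \<open>real m * dy\<^sup>2\<close> on
  the squared gradients, which this sum multiplies in the regret estimate.\<close>

lemma sum_step_size_le:
  assumes "m \<ge> 1"
  shows "real m * (\<Sum>t=1..n. step_size m t) \<le> 2 * sqrt (real m * real n)"
proof -
  have "real m * (\<Sum>t=1..n. step_size m t) \<le> real m * (\<Sum>t=1..n. 1 / sqrt (real m) * (1 / sqrt (real t)))"
    by (intro mult_left_mono sum_mono) (auto simp: step_size_def real_sqrt_mult)
  also have "\<dots> = sqrt (real m) * (\<Sum>t=1..n. 1 / sqrt (real t))"
    unfolding sum_distrib_left[symmetric] mult.assoc[symmetric] using assms by (simp add: real_div_sqrt)
  also have "\<dots> \<le> sqrt (real m) * (2 * sqrt (real n))"
    by (intro mult_left_mono sum_inverse_sqrt_le) simp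
  finally show ?thesis
    by (simp add: real_sqrt_mult)
qed

section \<open>Dual iterates\<close>

text \<open>A half-space is convex. Thus a choice that is optimal over \<open>S\<close> also beats
  comparators in the convex hull, for any linear objective.\<close>

lemma convex_hull_linear_le:
  fixes f :: "'a::real_vector \<Rightarrow> real"
  assumes "linear f" "\<And>z. z \<in> S \<Longrightarrow> f z \<le> c" "z \<in> convex hull S"
  shows "f z \<le> c"
proof -
  have "convex (f -` {..c})"
    using assms(1) by (intro convex_linear_vimage) auto
  then have "convex hull S \<subseteq> f -` {..c}"
    using assms(2) by (intro hull_minimal) auto
  then show ?thesis
    using assms(3) by auto
qed

lemma linear_lagrangian: "linear (\<lambda>z. reward z - dot m p (impact z))"
  by (intro linearI) (auto simp: reward_def impact_def dot_simps algebra_simps)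

lemma linear_impact_coord: "linear (\<lambda>z. impact z i)"
  by (intro linearI) (auto simp: impact_def scaleR_fun_def)

text \<open>In each coordinate the bound on \<open>S\<close> is a pair of linear inequalities, and
  both extend to the hull.\<close>

lemma hull_impact_bound:
  assumes "m \<ge> 1" "regular m \<Psi> Q dy dr dd S" "z \<in> convex hull S" "v \<in> Q" "i < m"
  shows "\<bar>impact z i - v i\<bar> \<le> dy"
proof -
  have b: "\<bar>impact z' i - v i\<bar> \<le> dy" if "z' \<in> S" for z'
    using that assms max_norm_le_iff[OF assms(1), of "impact z' - v" dy] by (auto simp: regular_def)
  have "impact z i \<le> v i + dy"
    using b by (intro convex_hull_linear_le[OF linear_impact_coord _ assms(3)]) (fastforce simp: abs_le_iff)
  moreover have "- impact z i \<le> dy - v i"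
    using b by (intro convex_hull_linear_le[OF linear_compose_neg[OF linear_impact_coord] _ assms(3)])
      (fastforce simp: abs_le_iff)
  ultimately show ?thesis
    by simp
qed

text \<open>Write \<open>u = q + c\<close>: the part in \<open>C\<close> contributes a nonpositive
  amount, and \<open>v\<close> is best within \<open>Q\<close>.\<close>

lemma polar_cone_dot_le:
  assumes "motzkin_decomposition m \<Psi> Q C" "p \<in> polar_cone m C"
    and "is_arg_max (\<lambda>u. dot m p u) (\<lambda>u. u \<in> Q) v" "u \<in> \<Psi>"
  shows "dot m p u \<le> dot m p v"
proof -
  obtain q c where "u = q + c" "q \<in> Q" "c \<in> C"
    using assms(1,4) by (auto simp: motzkin_decomposition_def)
  then show ?thesis
    using assms(2,3) by (force simp: dot_simps polar_cone_def is_arg_max_linorder)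
qed

text \<open>
  Comparing the primal choice with the Slater point and \<open>v\<close> with the Slater point moved by
  \<open>dd\<close> in the direction of \<open>p\<close>: a large dual iterate is pushed back towards the origin.
\<close>

lemma slater_drift:
  assumes "motzkin_decomposition m \<Psi> Q C" "regular m \<Psi> Q dy dr dd S" "p \<in> polar_cone m C"
    and w: "is_arg_max (\<lambda>z. reward z - dot m p (impact z)) (\<lambda>z. z \<in> S) w"
    and v: "is_arg_max (\<lambda>u. dot m p u) (\<lambda>u. u \<in> Q) v"
  shows "dd * eucl_norm m p - dr \<le> dot m p (v - impact w)"
proof -
  obtain z where z: "z \<in> convex hull S" "\<And>z'. z' \<in> S \<Longrightarrow> reward z \<ge> reward z' - dr"
    and ball: "{impact z + dd *\<^sub>R u |u. u \<in> coord_space m \<and> eucl_norm m u \<le> 1} \<subseteq> \<Psi>"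
    using assms(2) by (auto simp: regular_def)
  have "w \<in> S" and "reward z - dot m p (impact z) \<le> reward w - dot m p (impact w)"
    using w by (auto simp: is_arg_max_linorder
        intro!: convex_hull_linear_le[OF linear_lagrangian _ z(1), of m p])
  then have "dot m p (impact w) \<le> dot m p (impact z) + dr"
    using z(2)[OF \<open>w \<in> S\<close>] by linarith
  moreover have "dot m p (impact z) + dd * eucl_norm m p \<le> dot m p v"
  proof -
    \<comment> \<open>If the norm of \<open>p\<close> is zero, the convention
      \<open>1 / 0 = 0\<close> makes \<open>u\<close> zero, so that case needs no separate
      treatment.\<close>
    define u where "u = (1 / eucl_norm m p) *\<^sub>R p"
    have "u \<in> coord_space m" "eucl_norm m u \<le> 1"
      using assms(3) eucl_norm_nonneg[of m p] unfolding u_def eucl_norm_scaleR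
      by (auto simp: polar_cone_def coord_space_def scaleR_fun_def)
    then have "impact z + dd *\<^sub>R u \<in> \<Psi>"
      using ball by blast
    moreover have "dot m p u = eucl_norm m p"
      by (simp add: u_def dot_simps power2_eq_square flip: eucl_norm_power2)
    ultimately show ?thesis
      using polar_cone_dot_le[OF assms(1,3) v, of "impact z + dd *\<^sub>R u"] by (simp add: dot_simps)
  qed
  ultimately show ?thesis
    by (simp add: dot_simps)
qed

text \<open>Projecting onto the polar cone does not increase the norm, so the square of the
  unprojected step is an upper bound.\<close>

lemma dual_step:
  assumes "p' = eucl_proj m (polar_cone m C) (p - \<eta> *\<^sub>R g)"
  shows "dot m p' p' \<le> dot m p p - 2 * \<eta> * dot m p g + \<eta> * \<eta> * dot m g g"
proof -
  have "dot m p' p' \<le> dot m (p - \<eta> *\<^sub>R g) (p - \<eta> *\<^sub>R g)"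
    unfolding assms by (rule dot_self_eucl_proj_polar_cone_le)
  also have "\<dots> = dot m p p - 2 * \<eta> * dot m p g + \<eta> * \<eta> * dot m g g"
    by (simp add: dot_simps dot_commute[of m g p] algebra_simps)
  finally show ?thesis .
qed

text \<open>A bound on squared norms of dual iterates: the square of the radius beyond which the
  Slater drift dominates, plus the largest increase in one step from inside that radius.\<close>

definition dual_bound :: "real \<Rightarrow> real \<Rightarrow> real \<Rightarrow> real"
  where "dual_bound dy dr dd = ((dr + dy\<^sup>2 / 2) / dd)\<^sup>2 + 2 * dr + dy\<^sup>2"

lemma dual_step_bound:
  assumes "dr > 0" "dd > 0" and eta: "0 < \<eta>" "\<eta> * real m \<le> 1" "\<eta> \<le> 1"
    and g: "dot m g g \<le> real m * dy\<^sup>2"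
    and drift: "dd * eucl_norm m p - dr \<le> dot m p g"
    and step: "N' \<le> dot m p p - 2 * \<eta> * dot m p g + \<eta> * \<eta> * dot m g g"
    and p: "dot m p p \<le> dual_bound dy dr dd"
  shows "N' \<le> dual_bound dy dr dd"
proof -
  define K where "K = (dr + dy\<^sup>2 / 2) / dd"
  have "K \<ge> 0"
    using assms(1,2) by (simp add: K_def)
  \<comment> \<open>The condition \<open>\<eta> * real m \<le> 1\<close> absorbs the dimension in
    the squared gradient, leaving a term linear in \<open>\<eta>\<close>.\<close>
  have "\<eta> * \<eta> * dot m g g \<le> \<eta> * \<eta> * (real m * dy\<^sup>2)"
    using g by (intro mult_left_mono) auto
  also have "\<dots> = \<eta> * ((\<eta> * real m) * dy\<^sup>2)"
    by simp
  also have "\<dots> \<le> \<eta> * (1 * dy\<^sup>2)"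
    using eta by (intro mult_left_mono mult_right_mono) auto
  finally have N': "N' \<le> dot m p p + \<eta> * (dy\<^sup>2 - 2 * dot m p g)"
    using step by (simp add: algebra_simps)
  show ?thesis
  \<comment> \<open>At or beyond radius \<open>K\<close> the drift gives
    \<open>dot m p g \<ge> dy\<^sup>2 / 2\<close>, so the squared norm cannot grow. Inside it, one
    step adds at most \<open>dy\<^sup>2 + 2 * dr\<close>.\<close>
  proof (cases "eucl_norm m p \<ge> K")
    case True
    then have "dd * K \<le> dd * eucl_norm m p"
      using assms(2) by simp
    then have "dr + dy\<^sup>2 / 2 \<le> dd * eucl_norm m p"
      using assms(2) by (simp add: K_def)
    then have "\<eta> * (dy\<^sup>2 - 2 * dot m p g) \<le> 0"
      using drift eta(1) by (simp add: mult_le_0_iff)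
    then show ?thesis
      using N' p by linarith
  next
    case False
    then have "dot m p p \<le> K\<^sup>2"
      using eucl_norm_nonneg[of m p] unfolding eucl_norm_power2[symmetric] by (intro power_mono) auto
    moreover have "- dr \<le> dot m p g"
      using drift eucl_norm_nonneg[of m p] assms(2)
      by (smt (verit) mult_nonneg_nonneg)
    then have "\<eta> * (dy\<^sup>2 - 2 * dot m p g) \<le> \<eta> * (dy\<^sup>2 + 2 * dr)"
      using eta(1) by simp
    moreover have "\<eta> * (dy\<^sup>2 + 2 * dr) \<le> dy\<^sup>2 + 2 * dr"
      using eta assms(1) by (intro mult_left_le_one_le) auto
    ultimately show ?thesis
      using N' by (simp add: dual_bound_def K_def)
  qed
qed

text \<open>
  \<open>real m\<close> is \<open>1 / step_size m 1\<close>: since the first iterate vanishes, the constant part of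
  \<open>1 / step_size m t\<close> does not contribute.
\<close>

lemma weighted_telescope_le:
  fixes N :: "nat \<Rightarrow> real"
  assumes "m \<ge> 1" "N 1 = 0" "\<And>t. t \<in> {1..n} \<Longrightarrow> N t \<le> B" "n \<ge> 1"
  shows "(\<Sum>t=1..n. (N t - N (Suc t)) / step_size m t)
    \<le> B * (1 / step_size m n - real m) - N (Suc n) / step_size m n"
  using assms(4,3)
proof (induction n rule: dec_induct)
  case base
  have "1 / step_size m 1 = real m"
    using assms(1) by (subst inverse_step_size) (auto simp: max_def power2_eq_square intro!: antisym real_le_lsqrt)
  then show ?case
    using assms(2) by simp
next
  case (step n)
  have mono: "1 / step_size m n \<le> 1 / step_size m (Suc n)"
    using assms(1) step.hyps(1) unfolding inverse_step_size[OF assms(1) step.hyps(1)]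
      inverse_step_size[OF assms(1) le_SucI[OF step.hyps(1)]]
    by (intro max.mono order_refl real_sqrt_le_mono mult_left_mono) simp_all
  \<comment> \<open>Summation by parts: \<open>N (Suc n)\<close> meets the nonnegative increment of
    the weights, so it may be replaced by \<open>B\<close>.\<close>
  have "N (Suc n) * (1 / step_size m (Suc n) - 1 / step_size m n)
      \<le> B * (1 / step_size m (Suc n) - 1 / step_size m n)"
    using mono step.prems by (intro mult_right_mono) auto
  then show ?case
    using step.IH step.prems by (simp add: field_simps diff_divide_distrib)
qed

text \<open>Solve each step inequality for \<open>a t\<close> and sum. The weighted differences of
  \<open>N\<close> yield the term with \<open>B\<close>, the squared gradients the term with
  \<open>d\<^sup>2\<close>.\<close>

lemma regret_le:
  fixes N :: "nat \<Rightarrow> real"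
  assumes "m \<ge> 1" "T \<ge> 1" "N 1 = 0"
    and N: "\<And>t. t \<in> {1..Suc T} \<Longrightarrow> 0 \<le> N t \<and> N t \<le> B"
    and G: "\<And>t. t \<in> {1..T} \<Longrightarrow> G t \<le> real m * d\<^sup>2"
    and step: "\<And>t. t \<in> {1..T} \<Longrightarrow>
      N (Suc t) \<le> N t - 2 * step_size m t * a t + step_size m t * step_size m t * G t"
  shows "(\<Sum>t=1..T. a t) \<le> (B / 2 + d\<^sup>2) * sqrt (real m * real T)"
proof -
  let ?e = "step_size m"
  have "2 * a t \<le> (N t - N (Suc t)) / ?e t + d\<^sup>2 * (real m * ?e t)" if "t \<in> {1..T}" for t
  proof -
    have pos: "?e t > 0"
      using that assms(1) by (intro step_size_pos) auto
    have "2 * ?e t * a t \<le> N t - N (Suc t) + ?e t * ?e t * G t"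
      using step[OF that] by linarith
    also have "\<dots> \<le> N t - N (Suc t) + ?e t * ?e t * (real m * d\<^sup>2)"
      using G[OF that] pos by (intro add_left_mono mult_left_mono) auto
    finally show ?thesis
      using pos by (simp add: field_simps)
  qed
  then have "2 * (\<Sum>t=1..T. a t)
      \<le> (\<Sum>t=1..T. (N t - N (Suc t)) / ?e t) + d\<^sup>2 * (real m * (\<Sum>t=1..T. ?e t))"
    unfolding sum_distrib_left sum.distrib[symmetric] by (rule sum_mono)
  also have "\<dots> \<le> B * sqrt (real m * real T) + d\<^sup>2 * (2 * sqrt (real m * real T))"
  proof (intro add_mono mult_left_mono sum_step_size_le assms(1))
    have "(\<Sum>t=1..T. (N t - N (Suc t)) / ?e t) \<le> B * (1 / ?e T - real m) - N (Suc T) / ?e T"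
      using assms by (intro weighted_telescope_le) auto
    also have "\<dots> \<le> B * (1 / ?e T - real m)"
      using N[of "Suc T"] step_size_pos[OF assms(1,2)] by simp
    \<comment> \<open>The maximum of \<open>real m\<close> and
      \<open>sqrt (real m * real T)\<close>, less \<open>real m\<close>, is at most the root, also
      when \<open>T < m\<close>.\<close>
    also have "\<dots> \<le> B * sqrt (real m * real T)"
      using N[of 1] assms(2,3) unfolding inverse_step_size[OF assms(1,2)]
      by (intro mult_left_mono) (auto simp: max_def)
    finally show "(\<Sum>t=1..T. (N t - N (Suc t)) / ?e t) \<le> B * sqrt (real m * real T)" .
  qed simp
  finally show ?thesis
    by (simp add: algebra_simps)
qed

section \<open>Gradients and dual iterates along a run\<close>

lemma run_gap_bound:
  assumes "m \<ge> 1" "regular m \<Psi> Q dy dr dd S" "w \<in> S" "v \<in> Q"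
  shows "dot m (v - impact w) (v - impact w) \<le> real m * dy\<^sup>2"
proof (rule dot_self_le_of_coord_le)
  fix i assume "i < m"
  then have "\<bar>impact w i - v i\<bar> \<le> dy"
    using assms by (intro hull_impact_bound) (auto intro: hull_inc)
  then show "\<bar>(v - impact w) i\<bar> \<le> dy"
    by (simp add: abs_minus_commute)
qed

text \<open>Induction along the run; membership in the polar cone is carried along because the
  Slater drift requires it.\<close>

lemma run_dual_bound:
  assumes "m \<ge> 1" "dr > 0" "dd > 0" and mot: "motzkin_decomposition m \<Psi> Q C"
    and reg: "\<And>t. t \<in> {1..T} \<Longrightarrow> regular m \<Psi> Q dy dr dd (\<Omega> t)"
    and run: "primal_dual_run m T Q C (step_size m) \<Omega> w v p"
    and t: "t \<in> {1..Suc T}"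
  shows "p t \<in> polar_cone m C \<and> dot m (p t) (p t) \<le> dual_bound dy dr dd"
proof -
  have "1 \<le> t" "t \<le> Suc T"
    using t by auto
  then show ?thesis
  proof (induction t rule: dec_induct)
    case base
    have "p 1 = 0"
      using run unfolding primal_dual_run_def by blast
    then have "p 1 \<in> polar_cone m C" "dot m (p 1) (p 1) = 0"
      by (simp_all only: polar_cone_zero dot_zero)
    then show ?case
      using assms(2) by (simp add: dual_bound_def)
  next
    case (step t)
    then have t: "t \<in> {1..T}" and IH: "p t \<in> polar_cone m C" "dot m (p t) (p t) \<le> dual_bound dy dr dd"
      by auto
    have w: "is_arg_max (\<lambda>z. reward z - dot m (p t) (impact z)) (\<lambda>z. z \<in> \<Omega> t) (w t)"
      and v: "is_arg_max (\<lambda>u. dot m (p t) u) (\<lambda>u. u \<in> Q) (v t)"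
      and p: "p (Suc t) = eucl_proj m (polar_cone m C) (p t - step_size m t *\<^sub>R (v t - impact (w t)))"
      using run t by (auto simp: primal_dual_run_def)
    have le1: "step_size m t \<le> 1"
      unfolding step_size_def using assms(1) by (intro min.coboundedI1) simp
    have gap: "dot m (v t - impact (w t)) (v t - impact (w t)) \<le> real m * dy\<^sup>2"
      using w v by (intro run_gap_bound[OF assms(1) reg[OF t]]) (auto simp: is_arg_max_def)
    have "0 < step_size m t"
      using assms(1) t by (intro step_size_pos) auto
    then have "dot m (p (Suc t)) (p (Suc t)) \<le> dual_bound dy dr dd"
      by (rule dual_step_bound[OF assms(2,3) _ step_size_mult_le_1[OF assms(1)] le1 gap
            slater_drift[OF mot reg[OF t] IH(1) w v] dual_step[OF p] IH(2)])
    then show ?case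
      unfolding p by (simp only: eucl_proj_polar_cone_mem)
  qed
qed

section \<open>One run against a fixed comparator\<close>

text \<open>This holds for each arrival order separately. The sum of
  \<open>dot m (p t) (u - impact (z t))\<close> is the only term left for the averaging over
  permutations.\<close>

lemma run_reward_ge:
  assumes "m \<ge> 1" "T \<ge> 1" "dr > 0" "dd > 0" and mot: "motzkin_decomposition m \<Psi> Q C"
    and reg: "\<And>t. t \<in> {1..T} \<Longrightarrow> regular m \<Psi> Q dy dr dd (\<Omega> t)"
    and run: "primal_dual_run m T Q C (step_size m) \<Omega> w v p"
    and z: "\<And>t. t \<in> {1..T} \<Longrightarrow> z t \<in> convex hull (\<Omega> t)" and u: "u \<in> \<Psi>"
  shows "(\<Sum>t=1..T. reward (z t)) + (\<Sum>t=1..T. dot m (p t) (u - impact (z t)))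
    - (dual_bound dy dr dd / 2 + dy\<^sup>2) * sqrt (real m * real T) \<le> (\<Sum>t=1..T. reward (w t))"
proof -
  have w: "is_arg_max (\<lambda>z. reward z - dot m (p t) (impact z)) (\<lambda>z. z \<in> \<Omega> t) (w t)"
    and v: "is_arg_max (\<lambda>u. dot m (p t) u) (\<lambda>u. u \<in> Q) (v t)"
    and p: "p (Suc t) = eucl_proj m (polar_cone m C) (p t - step_size m t *\<^sub>R (v t - impact (w t)))"
    if "t \<in> {1..T}" for t
    using run that by (auto simp: primal_dual_run_def)
  have bound: "p t \<in> polar_cone m C \<and> dot m (p t) (p t) \<le> dual_bound dy dr dd"
    if "t \<in> {1..Suc T}" for t
    using run_dual_bound[OF assms(1,3,4) mot reg run that] .
  have "(\<Sum>t=1..T. dot m (p t) (v t - impact (w t)))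
      \<le> (dual_bound dy dr dd / 2 + dy\<^sup>2) * sqrt (real m * real T)"
  proof (rule regret_le[where N = "\<lambda>t. dot m (p t) (p t)"
        and G = "\<lambda>t. dot m (v t - impact (w t)) (v t - impact (w t))"])
    have "p 1 = 0"
      using run unfolding primal_dual_run_def by blast
    then show "dot m (p 1) (p 1) = 0"
      by (simp only: dot_zero)
    show "dot m (v t - impact (w t)) (v t - impact (w t)) \<le> real m * dy\<^sup>2" if "t \<in> {1..T}" for t
      using w[OF that] v[OF that]
      by (intro run_gap_bound[OF assms(1) reg[OF that]]) (auto simp: is_arg_max_def)
    show "0 \<le> dot m (p t) (p t) \<and> dot m (p t) (p t) \<le> dual_bound dy dr dd" if "t \<in> {1..Suc T}" for t
      using bound[OF that] dot_self_nonneg by blast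
  qed (rule assms(1,2) dual_step[OF p] | assumption)+
  moreover have "(\<Sum>t=1..T. reward (z t) + dot m (p t) (u - impact (z t)))
      \<le> (\<Sum>t=1..T. reward (w t) + dot m (p t) (v t - impact (w t)))"
  proof (rule sum_mono)
    fix t assume t: "t \<in> {1..T}"
    have "reward (z t) - dot m (p t) (impact (z t)) \<le> reward (w t) - dot m (p t) (impact (w t))"
      using w[OF t] by (intro convex_hull_linear_le[OF linear_lagrangian _ z[OF t]])
        (auto simp: is_arg_max_linorder)
    moreover have "dot m (p t) u \<le> dot m (p t) (v t)"
      using bound[of t] t by (intro polar_cone_dot_le[OF mot _ v[OF t] u]) auto
    ultimately show "reward (z t) + dot m (p t) (u - impact (z t))
        \<le> reward (w t) + dot m (p t) (v t - impact (w t))"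
      by (simp add: dot_simps)
  qed
  ultimately show ?thesis
    by (simp add: sum.distrib)
qed

section \<open>Random permutations\<close>

text \<open>Two positions that \<open>q\<close> does not distinguish are exchangeable given \<open>q\<close>.\<close>

lemma sum_permutes_exchange:
  assumes "s \<in> S" "t \<in> S"
    and "\<And>\<pi>. \<pi> permutes S \<Longrightarrow> q (\<pi> \<circ> Transposition.transpose s t) = q \<pi>"
  shows "(\<Sum>\<pi> | \<pi> permutes S. h (q \<pi>) (\<pi> s)) = (\<Sum>\<pi> | \<pi> permutes S. h (q \<pi>) (\<pi> t))"
proof -
  have "(\<Sum>\<pi> | \<pi> permutes S. h (q \<pi>) (\<pi> s))
      = (\<Sum>\<pi> | \<pi> permutes S. h (q (\<pi> \<circ> Transposition.transpose s t)) ((\<pi> \<circ> Transposition.transpose s t) s))"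
    by (rule sum_permutations_compose_right[OF permutes_swap_id[OF assms(1,2)]])
  also have "\<dots> = (\<Sum>\<pi> | \<pi> permutes S. h (q \<pi>) (\<pi> t))"
    using assms(3) by (intro sum.cong) auto
  finally show ?thesis .
qed

text \<open>Sampling a centred population without replacement gives nonpositive correlations.\<close>

lemma sum_permutes_correlation_nonpos:
  fixes d :: "'a \<Rightarrow> real"
  assumes "finite S" "(\<Sum>i\<in>S. d i) = 0" "s \<in> S" "t \<in> S" "s \<noteq> t"
  shows "(\<Sum>\<pi> | \<pi> permutes S. d (\<pi> s) * d (\<pi> t)) \<le> 0"
proof -
  let ?c = "\<lambda>t. \<Sum>\<pi> | \<pi> permutes S. d (\<pi> s) * d (\<pi> t)"
  \<comment> \<open>All partners of \<open>s\<close> give the same correlation, so they can be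
    summed together; centring turns the sum over the other positions into
    \<open>- d (\<pi> s)\<close>.\<close>
  have "?c t' = ?c t" if "t' \<in> S - {s}" for t'
    using that assms
    by (intro sum_permutes_exchange[where q = "\<lambda>\<pi>. \<pi> s" and h = "\<lambda>x y. d x * d y"])
      (auto simp: transpose_def)
  then have "real (card (S - {s})) * ?c t = (\<Sum>t'\<in>S - {s}. ?c t')"
    by simp
  also have "\<dots> = (\<Sum>\<pi> | \<pi> permutes S. d (\<pi> s) * (\<Sum>t'\<in>S - {s}. d (\<pi> t')))"
    by (subst sum.swap) (simp add: sum_distrib_left)
  also have "\<dots> = (\<Sum>\<pi> | \<pi> permutes S. - (d (\<pi> s))\<^sup>2)"
  proof (rule sum.cong[OF refl])
    fix \<pi> assume "\<pi> \<in> {\<pi>. \<pi> permutes S}"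
    then have "(\<Sum>t'\<in>S. d (\<pi> t')) = 0"
      using sum.permute[of \<pi> S d] assms(2) by (simp add: o_def)
    then have "(\<Sum>t'\<in>S - {s}. d (\<pi> t')) = - d (\<pi> s)"
      using assms(1,3) by (simp add: sum_diff1)
    then show "d (\<pi> s) * (\<Sum>t'\<in>S - {s}. d (\<pi> t')) = - (d (\<pi> s))\<^sup>2"
      by (simp add: power2_eq_square)
  qed
  also have "\<dots> \<le> 0"
    by (intro sum_nonpos) simp
  finally have "real (card (S - {s})) * ?c t \<le> 0" .
  moreover have "t \<in> S - {s}"
    using assms by simp
  then have "card (S - {s}) > 0"
    using assms(1) by (metis card_gt_0_iff empty_iff finite_Diff)
  ultimately show ?thesis
    by (simp add: mult_le_0_iff)
qed

text \<open>Expand the square: the off-diagonal terms are nonpositive correlations.\<close>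

lemma sum_permutes_square_le:
  fixes d :: "'a \<Rightarrow> real"
  assumes "finite S" "(\<Sum>i\<in>S. d i) = 0" "A \<subseteq> S"
  shows "(\<Sum>\<pi> | \<pi> permutes S. (\<Sum>s\<in>A. d (\<pi> s))\<^sup>2) \<le> (\<Sum>\<pi> | \<pi> permutes S. \<Sum>s\<in>A. (d (\<pi> s))\<^sup>2)"
proof -
  let ?c = "\<lambda>s t. \<Sum>\<pi> | \<pi> permutes S. d (\<pi> s) * d (\<pi> t)"
  have A: "finite A"
    using assms(1,3) finite_subset by blast
  have "(\<Sum>\<pi> | \<pi> permutes S. (\<Sum>s\<in>A. d (\<pi> s))\<^sup>2) = (\<Sum>s\<in>A. \<Sum>t\<in>A. ?c s t)"
    unfolding power2_eq_square sum_product
    by (subst sum.swap, rule sum.cong[OF refl], subst sum.swap, rule refl)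
  also have "\<dots> \<le> (\<Sum>s\<in>A. ?c s s)"
  proof (rule sum_mono)
    fix s assume s: "s \<in> A"
    have "(\<Sum>t\<in>A. ?c s t) = ?c s s + (\<Sum>t\<in>A - {s}. ?c s t)"
      by (rule sum.remove[OF A s])
    also have "\<dots> \<le> ?c s s + 0"
      using assms s by (intro add_left_mono sum_nonpos sum_permutes_correlation_nonpos) auto
    finally show "(\<Sum>t\<in>A. ?c s t) \<le> ?c s s" by simp
  qed
  also have "\<dots> = (\<Sum>\<pi> | \<pi> permutes S. \<Sum>s\<in>A. (d (\<pi> s))\<^sup>2)"
    by (subst sum.swap) (simp add: power2_eq_square)
  finally show ?thesis .
qed

text \<open>
  Since \<open>q\<close> is determined by the positions before \<open>t\<close>, the vector \<open>d (\<pi> t)\<close> may be replaced by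
  the average of \<open>d (\<pi> s)\<close> over \<open>s \<in> {t..T}\<close>, whose mean square is of order \<open>m / (T - t + 1)\<close>.
\<close>

lemma sum_permutes_adapted_dot_ge:
  assumes "m \<ge> 1" "t \<in> {1..T}"
    and adapted: "\<And>\<pi> s. \<pi> permutes {1..T} \<Longrightarrow> s \<in> {t..T} \<Longrightarrow>
      q (\<pi> \<circ> Transposition.transpose s t) = q \<pi>"
    and q: "\<And>\<pi>. \<pi> permutes {1..T} \<Longrightarrow> dot m (q \<pi>) (q \<pi>) \<le> B"
    and sum0: "\<And>j. j < m \<Longrightarrow> (\<Sum>i=1..T. d i j) = 0"
    and d: "\<And>i j. i \<in> {1..T} \<Longrightarrow> j < m \<Longrightarrow> \<bar>d i j\<bar> \<le> D"
  shows "- (real (card {\<pi>. \<pi> permutes {1..T}}) * ((B + D\<^sup>2) / 2) * (sqrt (real m) / sqrt (real (Suc T - t))))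
    \<le> (\<Sum>\<pi> | \<pi> permutes {1..T}. dot m (q \<pi>) (d (\<pi> t)))"
    (is "_ \<le> ?X")
proof -
  define P where "P = {\<pi>. \<pi> permutes {1..T}}"
  define k where "k = real (Suc T - t)"
  \<comment> \<open>This weight balances the two terms of Young's inequality: the squares of
    \<open>R\<close> sum to at most \<open>card P * (a * a) * D\<^sup>2\<close>, so both terms
    become proportional to \<open>a\<close>.\<close>
  define a where "a = sqrt (k * real m)"
  define R where "R \<pi> = (\<lambda>j. \<Sum>s\<in>{t..T}. d (\<pi> s) j)" for \<pi> :: "nat \<Rightarrow> nat"
  have k: "k > 0" "real (card {t..T}) = k"
    using assms(2) by (auto simp: k_def)
  have a: "a > 0" "a * a = k * real m" "a = sqrt k * sqrt (real m)"
    using assms(1) k(1) unfolding a_def by (auto simp: real_sqrt_mult[symmetric])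
  have "(\<Sum>\<pi>\<in>P. dot m (R \<pi>) (R \<pi>)) = (\<Sum>j<m. \<Sum>\<pi>\<in>P. (\<Sum>s\<in>{t..T}. d (\<pi> s) j)\<^sup>2)"
    unfolding dot_def R_def power2_eq_square by (rule sum.swap)
  also have "\<dots> \<le> (\<Sum>j<m. \<Sum>\<pi>\<in>P. \<Sum>s\<in>{t..T}. (d (\<pi> s) j)\<^sup>2)"
    unfolding P_def using sum0 assms(2)
    by (intro sum_mono sum_permutes_square_le) auto
  also have "\<dots> \<le> (\<Sum>j<m. \<Sum>\<pi>\<in>P. \<Sum>s\<in>{t..T}. D\<^sup>2)"
  proof (intro sum_mono)
    fix j \<pi> s assume "j \<in> {..<m}" "\<pi> \<in> P" "s \<in> {t..T}"
    then have "\<bar>d (\<pi> s) j\<bar> \<le> D"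
      using assms(2) permutes_in_image[of \<pi> "{1..T}" s] by (intro d) (auto simp: P_def)
    then show "(d (\<pi> s) j)\<^sup>2 \<le> D\<^sup>2"
      by (metis abs_ge_zero power2_abs power_mono)
  qed
  also have "\<dots> = real m * (real (card P) * (k * D\<^sup>2))"
    using k(2) by simp
  finally have var: "(\<Sum>\<pi>\<in>P. dot m (R \<pi>) (R \<pi>)) \<le> real (card P) * (a * a) * D\<^sup>2"
    unfolding a(2) by (simp add: mult_ac)
  have "- (real (card P) * a * ((B + D\<^sup>2) / 2))
      = - ((a * (real (card P) * B) + real (card P) * (a * a) * D\<^sup>2 / a) / 2)"
    using a(1) by (simp add: field_simps)
  also have "\<dots> \<le> - ((a * (\<Sum>\<pi>\<in>P. dot m (q \<pi>) (q \<pi>)) + (\<Sum>\<pi>\<in>P. dot m (R \<pi>) (R \<pi>)) / a) / 2)"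
  proof -
    have "(\<Sum>\<pi>\<in>P. dot m (q \<pi>) (q \<pi>)) \<le> real (card P) * B"
      using q sum_bounded_above[of P "\<lambda>\<pi>. dot m (q \<pi>) (q \<pi>)" B] by (auto simp: P_def)
    then have "a * (\<Sum>\<pi>\<in>P. dot m (q \<pi>) (q \<pi>)) \<le> a * (real (card P) * B)"
      using a(1) by simp
    moreover have "(\<Sum>\<pi>\<in>P. dot m (R \<pi>) (R \<pi>)) / a \<le> real (card P) * (a * a) * D\<^sup>2 / a"
      using var a(1) by (intro divide_right_mono) auto
    ultimately show ?thesis
      unfolding neg_le_iff_le by (rule divide_right_mono[OF add_mono zero_le_numeral])
  qed
  also have "\<dots> = (\<Sum>\<pi>\<in>P. - ((a * dot m (q \<pi>) (q \<pi>) + dot m (R \<pi>) (R \<pi>) / a) / 2))"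
    by (simp add: sum_negf sum.distrib sum_distrib_left sum_divide_distrib add_divide_distrib
        minus_add_distrib sum_subtractf)
  also have "\<dots> \<le> (\<Sum>\<pi>\<in>P. dot m (q \<pi>) (R \<pi>))"
    by (intro sum_mono young_dot a)
  also have "\<dots> = (\<Sum>s\<in>{t..T}. \<Sum>\<pi>\<in>P. dot m (q \<pi>) (d (\<pi> s)))"
  proof -
    have "dot m (q \<pi>) (R \<pi>) = (\<Sum>s\<in>{t..T}. dot m (q \<pi>) (d (\<pi> s)))" for \<pi>
      unfolding dot_def R_def sum_distrib_left by (rule sum.swap)
    then show ?thesis
      by (simp add: sum.swap[of _ P])
  qed
  \<comment> \<open>Exchangeability of \<open>s\<close> and \<open>t\<close> given \<open>q\<close>
    makes each of the \<open>k\<close> remaining positions contribute \<open>?X\<close>; dividing by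
    \<open>k\<close> leaves \<open>a / k\<close>, which is
    \<open>sqrt (real m) / sqrt k\<close>.\<close>
  also have "\<dots> = (\<Sum>s\<in>{t..T}. ?X)"
    unfolding P_def using adapted assms(2)
    by (intro sum.cong refl sum_permutes_exchange[where h = "\<lambda>x y. dot m x (d y)"]) auto
  also have "\<dots> = k * ?X"
    using k(2) by simp
  finally have *: "- (real (card P) * a * ((B + D\<^sup>2) / 2)) \<le> k * ?X" .
  have "a = k * (sqrt (real m) / sqrt k)"
    using k(1) a(3) by (simp add: field_simps)
  then have "k * - (real (card P) * ((B + D\<^sup>2) / 2) * (sqrt (real m) / sqrt k)) \<le> k * ?X"
    using * by (simp add: mult_ac)
  then show ?thesis
    using k(1) unfolding P_def[symmetric] k_def[symmetric] by (rule mult_left_le_imp_le)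
qed

section \<open>Online runs averaged over arrival orders\<close>

text \<open>The set observed at time \<open>t\<close> first influences \<open>p (Suc t)\<close>, so
  agreement strictly before \<open>t\<close> already fixes \<open>p t\<close>.\<close>

lemma run_dual_adapted:
  assumes "primal_dual_run m T Q C \<eta> (Z \<circ> \<pi>)
      (\<lambda>t. cw (history (Z \<circ> \<pi>) t)) (\<lambda>t. cv (history (Z \<circ> \<pi>) t)) p"
    and "primal_dual_run m T Q C \<eta> (Z \<circ> \<pi>')
      (\<lambda>t. cw (history (Z \<circ> \<pi>') t)) (\<lambda>t. cv (history (Z \<circ> \<pi>') t)) p'"
    and "1 \<le> t" "t \<le> Suc T" "\<And>i. i < t \<Longrightarrow> \<pi> i = \<pi>' i"
  shows "p t = p' t"
  using assms(3,4,5)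
proof (induction t rule: dec_induct)
  case base
  then show ?case
    using assms(1,2) by (simp add: primal_dual_run_def)
next
  case (step t)
  have "history (Z \<circ> \<pi>) t = history (Z \<circ> \<pi>') t"
    using step.prems(2) by (auto simp: history_def)
  moreover have "p t = p' t"
    using step by simp
  moreover have "t \<in> {1..T}"
    using step by simp
  ultimately show ?case
    using assms(1,2) by (simp add: primal_dual_run_def)
qed

lemma online_expected_reward_ge:
  fixes dy dr dd :: real and p :: "(nat \<Rightarrow> nat) \<Rightarrow> nat \<Rightarrow> rvec"
  assumes m: "m \<ge> 1" and T: "T \<ge> 1" and pos: "dy > 0" "dr > 0" "dd > 0"
    and mot: "motzkin_decomposition m \<Psi> Q C"
    and reg: "\<And>i. i \<in> {1..T} \<Longrightarrow> regular m \<Psi> Q dy dr dd (Z i)"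
    and run: "\<And>\<pi>. \<pi> permutes {1..T} \<Longrightarrow>
         primal_dual_run m T Q C (step_size m) (Z \<circ> \<pi>)
           (\<lambda>t. cw (history (Z \<circ> \<pi>) t)) (\<lambda>t. cv (history (Z \<circ> \<pi>) t)) (p \<pi>)"
    and s: "s \<in> benchmark_values T \<Psi> Z"
  shows "s - (3 / 2 * dual_bound dy dr dd + 5 * dy\<^sup>2) * sqrt (real m * real T)
    \<le> measure_pmf.expectation (pmf_of_set {\<pi>. \<pi> permutes {1..T}})
          (\<lambda>\<pi>. \<Sum>t=1..T. reward (cw (history (Z \<circ> \<pi>) t)))"
proof -
  define B where "B = dual_bound dy dr dd"
  define P where "P = {\<pi>. \<pi> permutes {1..T}}"
  define N where "N = real (card P)"
  define L where "L = sqrt (real m * real T)"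
  define rew where "rew \<pi> = (\<Sum>t=1..T. reward (cw (history (Z \<circ> \<pi>) t)))" for \<pi>
  have P: "finite P" "P \<noteq> {}"
    using permutes_id[of "{1..T}"] unfolding P_def by (blast intro: finite_permutations finite_atLeastAtMost)+
  then have N: "N > 0"
    by (simp add: N_def card_gt_0_iff)
  obtain w u where s_eq: "s = (\<Sum>t=1..T. reward (w t))"
    and w: "\<And>t. t \<in> {1..T} \<Longrightarrow> w t \<in> convex hull (Z t)"
    and u: "u \<in> \<Psi>" and wu: "(\<Sum>t=1..T. impact (w t)) = real T *\<^sub>R u"
    using s by (auto simp: benchmark_values_def)
  define d where "d i = u - impact (w i)" for i
  have u_coord: "real T * u j = (\<Sum>i=1..T. impact (w i) j)" for j
  proof -
    have "(\<Sum>i\<in>A. impact (w i)) j = (\<Sum>i\<in>A. impact (w i) j)" if "finite A" for A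
      using that by induction auto
    then show ?thesis
      using fun_cong[OF wu, of j] by (simp add: scaleR_fun_def)
  qed
  have sum0: "(\<Sum>i=1..T. d i j) = 0" for j
    using u_coord[of j] by (simp add: d_def sum_subtractf)
  obtain v where "v \<in> Q"
    using mot by (auto simp: motzkin_decomposition_def)
  \<comment> \<open>The mean \<open>u\<close> inherits the bound \<open>dy\<close> on the distance
    to \<open>v\<close> in each coordinate; the triangle inequality through \<open>v\<close> gives
    \<open>2 * dy\<close>.\<close>
  have d_le: "\<bar>d i j\<bar> \<le> 2 * dy" if "i \<in> {1..T}" "j < m" for i j
  proof -
    have b: "\<bar>impact (w i) j - v j\<bar> \<le> dy" if "i \<in> {1..T}" for i
      using that \<open>j < m\<close> \<open>v \<in> Q\<close> by (intro hull_impact_bound[OF m reg w])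
    have "\<bar>real T * (u j - v j)\<bar> = \<bar>\<Sum>i=1..T. impact (w i) j - v j\<bar>"
      by (simp add: sum_subtractf u_coord right_diff_distrib)
    also have "\<dots> \<le> (\<Sum>i=1..T. \<bar>impact (w i) j - v j\<bar>)"
      by (rule sum_abs)
    also have "\<dots> \<le> real T * dy"
      using b sum_bounded_above[of "{1..T}" "\<lambda>i. \<bar>impact (w i) j - v j\<bar>" dy] by simp
    finally have "\<bar>u j - v j\<bar> \<le> dy"
      using T by (simp add: abs_mult)
    then show ?thesis
      using b[OF that(1)] by (simp add: d_def)
  qed
  have regZ: "regular m \<Psi> Q dy dr dd ((Z \<circ> \<pi>) t)" if "\<pi> \<in> P" "t \<in> {1..T}" for \<pi> t
    using that permutes_in_image[of \<pi> "{1..T}" t] by (auto simp: P_def intro!: reg)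
  have "(\<Sum>\<pi>\<in>P. s + (\<Sum>t=1..T. dot m (p \<pi> t) (d (\<pi> t))) - (B / 2 + dy\<^sup>2) * L) \<le> (\<Sum>\<pi>\<in>P. rew \<pi>)"
  proof (rule sum_mono)
    fix \<pi> assume \<pi>: "\<pi> \<in> P"
    have "(\<Sum>t=1..T. reward (w (\<pi> t))) = s"
      using sum.permute[of \<pi> "{1..T}" "\<lambda>t. reward (w t)"] \<pi> by (simp add: P_def s_eq o_def)
    moreover have "w (\<pi> t) \<in> convex hull ((Z \<circ> \<pi>) t)" if "t \<in> {1..T}" for t
      using that \<pi> permutes_in_image[of \<pi> "{1..T}" t] by (auto simp: P_def intro!: w)
    ultimately show "s + (\<Sum>t=1..T. dot m (p \<pi> t) (d (\<pi> t))) - (B / 2 + dy\<^sup>2) * L \<le> rew \<pi>"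
      using run_reward_ge[OF m T pos(2,3) mot regZ[OF \<pi>] run, of "\<lambda>t. w (\<pi> t)" u] \<pi> u
      by (simp add: P_def B_def L_def rew_def d_def)
  qed
  then have "N * (s - (B / 2 + dy\<^sup>2) * L) + (\<Sum>t=1..T. \<Sum>\<pi>\<in>P. dot m (p \<pi> t) (d (\<pi> t)))
      \<le> (\<Sum>\<pi>\<in>P. rew \<pi>)"
    by (simp add: sum.distrib sum_subtractf N_def algebra_simps sum.swap[of _ P])
  moreover have "- (N * ((B + 4 * dy\<^sup>2) * L)) \<le> (\<Sum>t=1..T. \<Sum>\<pi>\<in>P. dot m (p \<pi> t) (d (\<pi> t)))"
  proof -
    have "(\<Sum>t=1..T. sqrt (real m) / sqrt (real (Suc T - t))) = (\<Sum>t=1..T. sqrt (real m) / sqrt (real t))"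
      by (rule sum.reindex_bij_witness[of _ "\<lambda>t. Suc T - t" "\<lambda>t. Suc T - t"]) auto
    also have "\<dots> \<le> 2 * L"
      using mult_left_mono[OF sum_inverse_sqrt_le[of T], of "sqrt (real m)"]
      by (simp add: L_def real_sqrt_mult sum_distrib_left)
    finally have "(\<Sum>t=1..T. sqrt (real m) / sqrt (real (Suc T - t))) \<le> 2 * L" .
    moreover have "B \<ge> 0"
      using pos by (simp add: B_def dual_bound_def)
    ultimately have "N * ((B + (2 * dy)\<^sup>2) / 2) * (\<Sum>t=1..T. sqrt (real m) / sqrt (real (Suc T - t)))
        \<le> N * ((B + (2 * dy)\<^sup>2) / 2) * (2 * L)"
      using N by (intro mult_left_mono) auto
    then have "- (N * ((B + 4 * dy\<^sup>2) * L))
        \<le> (\<Sum>t=1..T. - (N * ((B + (2 * dy)\<^sup>2) / 2) * (sqrt (real m) / sqrt (real (Suc T - t)))))"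
      unfolding sum_negf sum_distrib_left[symmetric] by (simp add: power_mult_distrib)
    also have "\<dots> \<le> (\<Sum>t=1..T. \<Sum>\<pi>\<in>P. dot m (p \<pi> t) (d (\<pi> t)))"
    proof (rule sum_mono)
      fix t assume t: "t \<in> {1..T}"
      show "- (N * ((B + (2 * dy)\<^sup>2) / 2) * (sqrt (real m) / sqrt (real (Suc T - t))))
          \<le> (\<Sum>\<pi>\<in>P. dot m (p \<pi> t) (d (\<pi> t)))"
        unfolding N_def P_def
      proof (rule sum_permutes_adapted_dot_ge[OF m t])
        fix \<pi> assume \<pi>: "\<pi> permutes {1..T}"
        show "dot m (p \<pi> t) (p \<pi> t) \<le> B"
          using run_dual_bound[OF m pos(2,3) mot regZ run[OF \<pi>]] \<pi> t by (auto simp: P_def B_def)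
        fix s assume s: "s \<in> {t..T}"
        \<comment> \<open>As \<open>s \<ge> t\<close>, the swap leaves all positions before
          \<open>t\<close> unchanged.\<close>
        have "\<pi> \<circ> Transposition.transpose s t permutes {1..T}"
          using s t by (intro permutes_compose[OF permutes_swap_id \<pi>]) auto
        from run_dual_adapted[OF run[OF this] run[OF \<pi>], of t]
        show "p (\<pi> \<circ> Transposition.transpose s t) t = p \<pi> t"
          using s t by (auto simp: transpose_def)
      qed (use sum0 d_le in auto)
    qed
    finally show ?thesis .
  qed
  \<comment> \<open>The regret contributes \<open>B / 2 + dy\<^sup>2\<close> and the sampling error
    \<open>B + 4 * dy\<^sup>2\<close>.\<close>
  ultimately have "N * (s - (3 / 2 * B + 5 * dy\<^sup>2) * L) \<le> (\<Sum>\<pi>\<in>P. rew \<pi>)"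
    by (simp add: algebra_simps)
  then have "s - (3 / 2 * B + 5 * dy\<^sup>2) * L \<le> (\<Sum>\<pi>\<in>P. rew \<pi>) / N"
    using N by (simp add: field_simps)
  also have "\<dots> = measure_pmf.expectation (pmf_of_set P) rew"
    using P by (simp add: integral_pmf_of_set N_def)
  finally show ?thesis
    unfolding P_def rew_def[abs_def] B_def L_def .
qed

theorem theorem4p7:
  fixes dy dr dd :: real
  assumes "dy > 0" and "dr > 0" and "dd > 0"
  shows "\<exists>M :: real.
    \<forall>(m :: nat) (n :: nat) (T :: nat) (\<Psi> :: rvec set) (Q :: rvec set) (C :: rvec set)
      (Z :: nat \<Rightarrow> decision set)
      (choose_w :: decision set list \<Rightarrow> decision) (choose_v :: decision set list \<Rightarrow> rvec)
      (p :: (nat \<Rightarrow> nat) \<Rightarrow> nat \<Rightarrow> rvec).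
      m \<ge> 1 \<longrightarrow> T \<ge> 1 \<longrightarrow>
      motzkin_decomposition m \<Psi> Q C \<longrightarrow>
      (\<forall>i\<in>{1..T}. local_feasible_set m n (Z i) \<and> regular m \<Psi> Q dy dr dd (Z i)) \<longrightarrow>
      benchmark_values T \<Psi> Z \<noteq> {} \<longrightarrow>
      (\<forall>\<pi>. \<pi> permutes {1..T} \<longrightarrow>
         primal_dual_run m T Q C (step_size m) (Z \<circ> \<pi>)
           (\<lambda>t. choose_w (history (Z \<circ> \<pi>) t)) (\<lambda>t. choose_v (history (Z \<circ> \<pi>) t)) (p \<pi>)) \<longrightarrow>
      measure_pmf.expectation (pmf_of_set {\<pi>. \<pi> permutes {1..T}})
          (\<lambda>\<pi>. \<Sum>t=1..T. reward (choose_w (history (Z \<circ> \<pi>) t)))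
        \<ge> benchmark T \<Psi> Z - M * sqrt (real m * max 1 (ln (real m))) * sqrt (real T)"
proof (rule exI[of _ "3 / 2 * dual_bound dy dr dd + 5 * dy\<^sup>2"], intro allI impI)
  fix m n T :: nat and \<Psi> Q C :: "rvec set" and Z :: "nat \<Rightarrow> decision set"
    and choose_w :: "decision set list \<Rightarrow> decision" and choose_v :: "decision set list \<Rightarrow> rvec"
    and p :: "(nat \<Rightarrow> nat) \<Rightarrow> nat \<Rightarrow> rvec"
  assume m: "m \<ge> 1" and T: "T \<ge> 1" and mot: "motzkin_decomposition m \<Psi> Q C"
    and reg: "\<forall>i\<in>{1..T}. local_feasible_set m n (Z i) \<and> regular m \<Psi> Q dy dr dd (Z i)"
    and feas: "benchmark_values T \<Psi> Z \<noteq> {}"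
    and run: "\<forall>\<pi>. \<pi> permutes {1..T} \<longrightarrow>
         primal_dual_run m T Q C (step_size m) (Z \<circ> \<pi>)
           (\<lambda>t. choose_w (history (Z \<circ> \<pi>) t)) (\<lambda>t. choose_v (history (Z \<circ> \<pi>) t)) (p \<pi>)"
  let ?M = "3 / 2 * dual_bound dy dr dd + 5 * dy\<^sup>2"
  let ?E = "measure_pmf.expectation (pmf_of_set {\<pi>. \<pi> permutes {1..T}})
          (\<lambda>\<pi>. \<Sum>t=1..T. reward (choose_w (history (Z \<circ> \<pi>) t)))"
  \<comment> \<open>The expectation bound is uniform over attainable values \<open>s\<close>, hence
    passes to their supremum.\<close>
  have "benchmark T \<Psi> Z \<le> ?E + ?M * sqrt (real m * real T)"
    unfolding benchmark_def
  proof (rule cSup_least[OF feas])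
    fix s assume "s \<in> benchmark_values T \<Psi> Z"
    from online_expected_reward_ge[OF m T assms mot _ _ this, of choose_w choose_v p]
    show "s \<le> ?E + ?M * sqrt (real m * real T)"
      using reg run by simp
  qed
  \<comment> \<open>The logarithmic factor enters here: it is at least 1 and \<open>?M\<close> is
    nonnegative.\<close>
  moreover have "?M * sqrt (real m * real T)
      \<le> ?M * sqrt (real m * max 1 (ln (real m))) * sqrt (real T)"
  proof -
    have "0 \<le> ?M"
      using assms by (simp add: dual_bound_def)
    moreover have "sqrt (real m) \<le> sqrt (real m * max 1 (ln (real m)))"
      using m by (simp add: mult_le_cancel_left1)
    ultimately show ?thesis
      unfolding real_sqrt_mult[of "real m" "real T"] mult.assoc
      by (intro mult_left_mono mult_right_mono) auto
  qed
  ultimately show "?E \<ge> benchmark T \<Psi> Z - ?M * sqrt (real m * max 1 (ln (real m))) * sqrt (real T)"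
    by linarith
qed

end
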